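(* Suppose $\prec$ is the algorithmic breadth-first traversal of a nonempty wellordered connected graph $(V,E,<)$ and that $(V,<)$ has order type $\alpha$. Then $(V,\prec)$ has order type at most $\alpha^\omega$ (ordinal exponentiation).
   Context: A wellordered connected graph $(V,E,<)$ is a connected undirected graph $(V,E)$ (possibly infinite) together with a wellordering $<$ of $V$. Deterministic breadth-first search on $(V,E,<)$: define sets $B_\alpha$ and sequences $Q_\alpha$ (regarded both as sequences and as sets) by transfinite recursion, where $q_\alpha$ denotes the first element of $Q_\alpha\setminus B_\alpha$ whenever that is nonempty. $B_0=\emptyset$ and $Q_0=(v_0)$, where $v_0$ is the $<$-least element of $V$. If $Q_\alpha\setminus B_\alpha\neq\emptyset$, then $B_{\alpha+1}=B_\alpha\cup\{q_\alpha\}$ and $Q_{\alpha+1}$ is obtained from $Q_\alpha$ by appending at the end, in $<$-order, all neighbors of $q_\alpha$ not in $Q_\alpha$; otherwise $B_{\alpha+1}=B_\alpha$ and $Q_{\alpha+1}=Q_\alpha$. At limit $\alpha$, $B_\alpha=\bigcup_{\beta<\alpha}B_\beta$ and $Q_\alpha=\bigcup_{\beta<\alpha}Q_\beta$ (each later sequence end-extends the earlier ones). The closure ordinal $\Gamma$ is the least ordinal with $B_\Gamma=B_{\Gamma+1}$; one has $B_\Gamma=V$, so $\alpha\mapsto q_\alpha$ is a bijection $\Gamma\to V$. The algorithmic breadth-first traversal is the wellordering $\prec$ of $V$ with $q_\alpha\prec q_\beta$ iff $\alpha<\beta$. *)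

theory Defs
  imports "HOL-Algebra.Free_Abelian_Groups"
begin

(* Free_Abelian_Groups is imported for the HOL-Cardinals theories below it, in particular
   Order_Union (Osum) and Wellorder_Constructions (succ, zero, worecZSL).
   Following those theories, a well-order is a reflexive relation "r :: 'a rel" (pairs (x, y)
   with x below or equal to y), ordinals are well-orders up to ordIso, and "r <=o s" compares
   order types. *)

unbundle cardinal_syntax

section \<open>Ordinal exponentiation\<close>

(* Hausdorff's description of the ordinal power: functions of finite support from the exponent
   to the base, compared at the largest argument where they differ. Func (library) makes them
   "undefined" outside Field s. *)
definition fin_supp :: "'b rel \<Rightarrow> 'c rel \<Rightarrow> ('c \<Rightarrow> 'b) set" where
  "fin_supp r s =
    {f \<in> Func (Field s) (Field r). finite {x \<in> Field s. f x \<noteq> wo_rel.zero r}}"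

definition oexp :: "'b rel \<Rightarrow> 'c rel \<Rightarrow> ('c \<Rightarrow> 'b) rel"  (infixr \<open>^o\<close> 90) where
  "r ^o s =
    {(f, g). f \<in> fin_supp r s \<and> g \<in> fin_supp r s \<and>
       (f = g \<or>
        (\<exists>m \<in> Field s. (f m, g m) \<in> r - Id \<and> (\<forall>x. (m, x) \<in> s - Id \<longrightarrow> f x = g x)))}"

section \<open>Wellordered connected graphs\<close>

(* An undirected graph is given by its symmetric adjacency relation E; loops are neither
   required nor excluded, and the search below ignores them. *)
definition wo_connected_graph :: "'a set \<Rightarrow> 'a rel \<Rightarrow> 'a rel \<Rightarrow> bool" where
  "wo_connected_graph V E lt \<longleftrightarrow>
     E \<subseteq> V \<times> V \<and> sym E \<and> (\<forall>u \<in> V. \<forall>v \<in> V. (u, v) \<in> E\<^sup>*) \<and> well_order_on V lt"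

section \<open>Deterministic breadth-first search\<close>

(* The ordinals indexing the stages are the elements of an initial ordinal that is infinite
   (hence closed under successor) and of cardinality greater than that of V. As each stage
   before the closure ordinal contributes a new vertex, this is long enough to contain the
   closure ordinal. *)
definition stage_ord :: "'a set \<Rightarrow> (nat + 'a) set rel" where
  "stage_ord V = cardSuc (natLeq +c |V| )"

(* The pair (B, Q) is one stage. Q has no repetitions, so as a transfinite sequence it is the
   same thing as a well-order on the set Field Q of its entries; then end-extension is
   concatenation of orders (Osum), and the limit of a chain of end-extensions is its union. *)
definition queue_head :: "'a set \<times> 'a rel \<Rightarrow> 'a" where
  "queue_head = (\<lambda>(B, Q). wo_rel.minim Q (Field Q - B))"

definition bfs_step :: "'a rel \<Rightarrow> 'a rel \<Rightarrow> 'a set \<times> 'a rel \<Rightarrow> 'a set \<times> 'a rel" where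
  "bfs_step E lt = (\<lambda>(B, Q).
     if Field Q - B \<noteq> {}
     then (let q = queue_head (B, Q) in
             (B \<union> {q}, Q Osum Restr lt (E `` {q} - Field Q)))
     else (B, Q))"

definition bfs_stage ::
    "'a set \<Rightarrow> 'a rel \<Rightarrow> 'a rel \<Rightarrow> (nat + 'a) set \<Rightarrow> 'a set \<times> 'a rel" where
  "bfs_stage V E lt =
     wo_rel.worecZSL (stage_ord V)
       (let v0 = wo_rel.minim lt V in ({}, {(v0, v0)}))
       (\<lambda>a. bfs_step E lt)
       (\<lambda>f a. (\<Union>b \<in> underS (stage_ord V) a. fst (f b),
               \<Union>b \<in> underS (stage_ord V) a. snd (f b)))"

definition bfs_B :: "'a set \<Rightarrow> 'a rel \<Rightarrow> 'a rel \<Rightarrow> (nat + 'a) set \<Rightarrow> 'a set" where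
  "bfs_B V E lt a = fst (bfs_stage V E lt a)"

definition bfs_q :: "'a set \<Rightarrow> 'a rel \<Rightarrow> 'a rel \<Rightarrow> (nat + 'a) set \<Rightarrow> 'a" where
  "bfs_q V E lt a = queue_head (bfs_stage V E lt a)"

definition bfs_closure :: "'a set \<Rightarrow> 'a rel \<Rightarrow> 'a rel \<Rightarrow> (nat + 'a) set" where
  "bfs_closure V E lt =
     wo_rel.minim (stage_ord V)
       {a \<in> Field (stage_ord V).
          bfs_B V E lt a = bfs_B V E lt (wo_rel.succ (stage_ord V) a)}"

definition bfs_traversal :: "'a set \<Rightarrow> 'a rel \<Rightarrow> 'a rel \<Rightarrow> 'a rel" where
  "bfs_traversal V E lt =
     {(bfs_q V E lt a, bfs_q V E lt b) | a b.
        (a, b) \<in> stage_ord V \<and>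
        a \<in> underS (stage_ord V) (bfs_closure V E lt) \<and>
        b \<in> underS (stage_ord V) (bfs_closure V E lt)}"

end

theory Submission
  imports Defs
begin

text \<open>
  Write \<open>v0\<close> for the starting vertex, and let the parent of a vertex \<open>v \<noteq> v0\<close> be the vertex whose
  search put \<open>v\<close> into the queue; let \<open>v0\<close> be its own parent.  The parent of \<open>v \<noteq> v0\<close> is searched
  strictly before \<open>v\<close>, so by wellfoundedness of the traversal the iterated parents of any vertex
  reach \<open>v0\<close> after finitely many steps.  Since \<open>v0\<close> is the zero of \<open>lt\<close>, the sequence
  \<open>i \<mapsto> parent\<^sup>i v\<close> has finite support: it is an element of Hausdorff's description of
  \<open>\<alpha>\<^sup>\<omega>\<close>, after transporting vertices along an isomorphism from \<open>lt\<close> onto \<open>\<alpha>\<close>.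

  This coding of vertices is strictly increasing, because breadth-first search uses a queue.
  Vertices are searched in the order in which they were queued, so the parent map is (weakly)
  monotone for the traversal, and vertices with the same parent are searched in \<open>lt\<close>-order.
  Now let \<open>v\<close> be searched before \<open>w\<close> and let \<open>m\<close> be the largest index where their sequences
  differ.  The entries at \<open>m\<close> are in traversal order by monotonicity, and have the same parent by
  the choice of \<open>m\<close>; hence they are in \<open>lt\<close>-order, which is what comparing at the largest
  difference requires.  The combinatorial part of this is \<open>ordLeq_oexp_natLeq_if_parent_map\<close>; the
  facts about the queue are \<open>queue_order_follows_search_order\<close> and
  \<open>siblings_searched_in_order\<close>.

  What remains is to control the transfinite recursion.  The queues form a chain of end-extensions
  and the searched vertices are always an initial segment of the queue, so each stage whose queue
  is not exhausted searches a new vertex.  As there are more stages than vertices, the queue gets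
  exhausted, and by connectedness every vertex has been searched by then.
\<close>

section \<open>Comparing order types by strictly monotone maps\<close>

text \<open>Otherwise a least \<open>x\<close> with \<open>h x\<close> below \<open>x\<close> would give the smaller \<open>h x\<close> with \<open>h (h x)\<close> below \<open>h x\<close>.\<close>

lemma Well_order_strict_self_map_above:
  assumes wo: "Well_order r"
    and maps: "\<And>x. x \<in> Field r \<Longrightarrow> h x \<in> Field r"
    and mono: "\<And>x y. (x, y) \<in> r - Id \<Longrightarrow> (h x, h y) \<in> r - Id"
    and x: "x \<in> Field r"
  shows "(x, h x) \<in> r"
proof -
  interpret wo_rel r using wo by (simp add: wo_rel_def)
  have "x \<in> Field r \<longrightarrow> (h x, x) \<notin> r - Id"
  proof (induction x rule: wf_induct[OF WF])
    case (1 x)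
    then show ?case
      using mono maps by blast
  qed
  then show ?thesis
    using x maps TOTALS by (metis DiffI Id_O_R R_O_Id pair_in_Id_conv)
qed

text \<open>By definition \<open>\<le>o\<close> asks for an embedding onto an initial segment.  A strictly monotone map is
  enough: if \<open>s\<close> were shorter than \<open>r\<close>, it would be isomorphic to a proper initial segment of \<open>r\<close>, and
  composing would send the bound \<open>a\<close> of that segment strictly below itself.\<close>

lemma ordLeq_if_strict_mono:
  assumes r: "Well_order r" and s: "Well_order s"
    and maps: "\<And>x. x \<in> Field r \<Longrightarrow> f x \<in> Field s"
    and mono: "\<And>x y. (x, y) \<in> r - Id \<Longrightarrow> (f x, f y) \<in> s - Id"
  shows "r \<le>o s"
proof (rule ccontr)
  assume "\<not> r \<le>o s"
  then have "s <o r" using r s by simp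
  then obtain a where a: "a \<in> Field r" "s =o Restr r (underS r a)"
    using ordLess_iff_ordIso_Restr[OF r s] by blast
  then obtain g where "BNF_Wellorder_Embedding.iso s (Restr r (underS r a)) g"
    unfolding ordIso_def by blast
  then have bij: "bij_betw g (Field s) (Field (Restr r (underS r a)))"
    and iff: "\<forall>x \<in> Field s. \<forall>y \<in> Field s. (x, y) \<in> s \<longleftrightarrow> (g x, g y) \<in> Restr r (underS r a)"
    unfolding iso_iff2 by simp_all
  have "Field (Restr r (underS r a)) \<subseteq> underS r a"
    by (auto simp: Field_def)
  then have g_maps: "g y \<in> underS r a" if "y \<in> Field s" for y
    using bij_betwE[OF bij] that by blast
  have g_mono: "(g x, g y) \<in> r - Id" if "(x, y) \<in> s - Id" for x y
  proof -
    from that have xy: "x \<in> Field s" "y \<in> Field s" "x \<noteq> y" "(x, y) \<in> s"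
      by (auto simp: Field_def)
    then have "g x \<noteq> g y"
      using bij by (auto simp: bij_betw_def dest: inj_onD)
    then show ?thesis
      using iff xy by simp
  qed
  have "underS r a \<subseteq> Field r"
    by (auto simp: underS_def Field_def)
  then have gf_maps: "g (f x) \<in> Field r" if "x \<in> Field r" for x
    using g_maps[OF maps[OF that]] by (rule subsetD)
  have "(a, g (f a)) \<in> r"
    using Well_order_strict_self_map_above[OF r gf_maps g_mono[OF mono] a(1)] .
  moreover have "(g (f a), a) \<in> r" "g (f a) \<noteq> a"
    using g_maps[OF maps[OF a(1)]] by (auto simp: underS_def)
  ultimately show False
    using r by (simp add: order_on_defs) (meson antisymD)
qed

section \<open>The power with exponent omega is a well-order\<close>

lemma mem_fin_supp_natLeq:
  "f \<in> fin_supp r natLeq \<longleftrightarrow> range f \<subseteq> Field r \<and> finite {i. f i \<noteq> wo_rel.zero r}"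
  by (auto simp: fin_supp_def Func_def Field_natLeq)

lemma fin_supp_natLeq_in_Field: "f \<in> fin_supp r natLeq \<Longrightarrow> f i \<in> Field r"
  by (auto simp: mem_fin_supp_natLeq)

lemma mem_oexp_natLeq:
  "(f, g) \<in> r ^o natLeq \<longleftrightarrow> f \<in> fin_supp r natLeq \<and> g \<in> fin_supp r natLeq \<and>
     (f = g \<or> (\<exists>m. (f m, g m) \<in> r - Id \<and> (\<forall>i>m. f i = g i)))"
proof -
  have "(m, i) \<in> natLeq - Id \<longleftrightarrow> m < i" for m i
    by (auto simp: natLeq_def)
  then show ?thesis
    by (simp add: oexp_def Field_natLeq)
qed

lemma Field_oexp_natLeq: "Field (r ^o natLeq) = fin_supp r natLeq"
  by (auto simp: Field_def mem_oexp_natLeq)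

lemma largest_difference:
  fixes f g :: "nat \<Rightarrow> 'b"
  assumes "finite {i. f i \<noteq> z}" "finite {i. g i \<noteq> z}" "f k \<noteq> g k"
  obtains m where "f m \<noteq> g m" "\<And>i. m < i \<Longrightarrow> f i = g i" "k \<le> m"
proof -
  let ?D = "{i. f i \<noteq> g i}"
  have "?D \<subseteq> {i. f i \<noteq> z} \<union> {i. g i \<noteq> z}" by auto
  then have "finite ?D"
    using assms(1,2) by (meson finite_UnI finite_subset)
  moreover have "k \<in> ?D" using assms(3) by simp
  ultimately show thesis
    using Max_in[of ?D] Max_ge[of ?D] that[of "Max ?D"]
    by (metis (mono_tags, lifting) empty_iff leD mem_Collect_eq)
qed

text \<open>Lexicographic minimization, one coordinate at a time from the most significant one
  (index \<open>n - 1\<close>) downwards.\<close>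

lemma oexp_natLeq_least_of_agreeing_tails:
  assumes r: "Well_order r" and "S \<noteq> {}" and "S \<subseteq> fin_supp r natLeq"
    and "\<And>f g i. f \<in> S \<Longrightarrow> g \<in> S \<Longrightarrow> n \<le> i \<Longrightarrow> f i = g i"
  shows "\<exists>f \<in> S. \<forall>g \<in> S. (f, g) \<in> r ^o natLeq"
  using assms(2-)
proof (induction n arbitrary: S)
  case 0
  then obtain f where f: "f \<in> S" by blast
  have "f = g" if "g \<in> S" for g
    using 0(3)[OF f that] by auto
  then show ?case
    using f 0(2) by (auto simp: mem_oexp_natLeq)
next
  case (Suc n)
  interpret wo_rel r using r by (simp add: wo_rel_def)
  let ?A = "(\<lambda>f. f n) ` S"
  have A: "?A \<subseteq> Field r" "?A \<noteq> {}"
    using Suc.prems(1,2) fin_supp_natLeq_in_Field by blast+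
  define a where "a = minim ?A"
  have a: "a \<in> ?A" "\<And>b. b \<in> ?A \<Longrightarrow> (a, b) \<in> r"
    using A unfolding a_def by (auto intro: minim_in minim_least)
  let ?T = "{f \<in> S. f n = a}"
  have "\<exists>f \<in> ?T. \<forall>g \<in> ?T. (f, g) \<in> r ^o natLeq"
  proof (rule Suc.IH)
    show "?T \<noteq> {}" using a(1) by auto
    show "?T \<subseteq> fin_supp r natLeq" using Suc.prems(2) by auto
    show "f i = g i" if "f \<in> ?T" "g \<in> ?T" "n \<le> i" for f g i
      using that Suc.prems(3)[of f g i] by (cases "i = n") auto
  qed
  then obtain f where f: "f \<in> S" "f n = a" and least: "\<And>g. g \<in> ?T \<Longrightarrow> (f, g) \<in> r ^o natLeq"
    by blast
  have "(f, g) \<in> r ^o natLeq" if g: "g \<in> S" for g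
  proof (cases "g n = a")
    case True
    then show ?thesis using least g by simp
  next
    case False
    then have "(f n, g n) \<in> r - Id"
      using a(2)[of "g n"] f g by auto
    moreover have "\<forall>i>n. f i = g i"
      using Suc.prems(3)[OF f(1) g] by auto
    ultimately show ?thesis
      using f g Suc.prems(2) by (auto simp: mem_oexp_natLeq)
  qed
  then show ?case using f(1) by blast
qed

text \<open>If some member of \<open>S\<close> vanishes from index \<open>n\<close> on, then the least member among those that vanish
  from \<open>n\<close> on exists because their tails agree; every other member is nonzero at some index
  \<open>\<ge> n\<close>, and therefore larger.\<close>

lemma oexp_natLeq_least:
  assumes r: "Well_order r" and "S \<noteq> {}" and S: "S \<subseteq> fin_supp r natLeq"
  shows "\<exists>f \<in> S. \<forall>g \<in> S. (f, g) \<in> r ^o natLeq"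
proof -
  interpret wo_rel r using r by (simp add: wo_rel_def)
  obtain h where h: "h \<in> S" using assms(2) by blast
  then have "finite {i. h i \<noteq> zero}" using S by (auto simp: mem_fin_supp_natLeq)
  then obtain n where n: "\<forall>i\<in>{i. h i \<noteq> zero}. i < n"
    using finite_nat_set_iff_bounded by blast
  let ?T = "{f \<in> S. \<forall>i\<ge>n. f i = zero}"
  have "\<exists>f \<in> ?T. \<forall>g \<in> ?T. (f, g) \<in> r ^o natLeq"
  proof (rule oexp_natLeq_least_of_agreeing_tails[OF r])
    show "?T \<noteq> {}" using h n by fastforce
  qed (use S in auto)
  then obtain f where f: "f \<in> S" "\<And>i. n \<le> i \<Longrightarrow> f i = zero"
    and least: "\<And>g. g \<in> ?T \<Longrightarrow> (f, g) \<in> r ^o natLeq"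
    by blast
  have "(f, g) \<in> r ^o natLeq" if g: "g \<in> S" for g
  proof (cases "g \<in> ?T")
    case True
    then show ?thesis by (rule least)
  next
    case False
    then obtain k where k: "n \<le> k" "f k \<noteq> g k"
      using g f(2) by auto
    have fin: "finite {i. f i \<noteq> zero}" "finite {i. g i \<noteq> zero}" "f \<in> fin_supp r natLeq"
      "g \<in> fin_supp r natLeq"
      using f(1) g S mem_fin_supp_natLeq by blast+
    obtain m where m: "f m \<noteq> g m" "\<And>i. m < i \<Longrightarrow> f i = g i" "k \<le> m"
      using largest_difference[where z = zero] fin k(2) by metis
    then have "(f m, g m) \<in> r - Id"
      using k(1) f(2)[of m] fin(4) zero_smallest[OF fin_supp_natLeq_in_Field[OF fin(4), of m]] m(1,3)
      by auto
    then show ?thesis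
      using m(2) fin(3,4) by (auto simp: mem_oexp_natLeq)
  qed
  then show ?thesis using f(1) by blast
qed

lemma Well_order_oexp_natLeq:
  assumes r: "Well_order r"
  shows "Well_order (r ^o natLeq)"
proof -
  interpret wo_rel r using r by (simp add: wo_rel_def)
  let ?p = "r ^o natLeq"
  have refl: "Refl ?p"
    by (auto simp: refl_on_def Field_oexp_natLeq mem_oexp_natLeq)
  have antisym: "antisym ?p"
  proof (rule antisymI, rule ccontr)
    fix f g assume fg: "(f, g) \<in> ?p" "(g, f) \<in> ?p" "f \<noteq> g"
    then obtain m n where
      m: "(f m, g m) \<in> r - Id" "\<forall>i>m. f i = g i" and
      n: "(g n, f n) \<in> r - Id" "\<forall>i>n. g i = f i"
      unfolding mem_oexp_natLeq by blast
    then have "m = n"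
      by (metis DiffE IdI linorder_neqE_nat)
    then show False
      using m n ANTISYM by (auto simp: antisym_def)
  qed
  have trans: "trans ?p"
  proof (rule transI)
    fix f g h assume fg: "(f, g) \<in> ?p" and gh: "(g, h) \<in> ?p"
    show "(f, h) \<in> ?p"
    proof (cases "f = g \<or> g = h")
      case True
      then show ?thesis using fg gh by auto
    next
      case False
      then obtain m n where
        m: "(f m, g m) \<in> r - Id" "\<forall>i>m. f i = g i" and
        n: "(g n, h n) \<in> r - Id" "\<forall>i>n. g i = h i"
        using fg gh unfolding mem_oexp_natLeq by blast
      have strict_trans: "trans (r - Id)"
        using TRANS ANTISYM trans_diff_Id by blast
      have "(f (max m n), h (max m n)) \<in> r - Id"
      proof (cases m n rule: linorder_cases)
        case less
        then show ?thesis using m n by (simp add: max_def)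
      next
        case equal
        then show ?thesis using transD[OF strict_trans m(1)] n(1) by (simp add: max_def)
      next
        case greater
        then show ?thesis using m n by (simp add: max_def)
      qed
      moreover have "\<forall>i > max m n. f i = h i"
        using m(2) n(2) by simp
      ultimately show ?thesis
        using fg gh unfolding mem_oexp_natLeq by blast
    qed
  qed
  have total: "Total ?p"
    unfolding total_on_def Field_oexp_natLeq
  proof (intro ballI impI)
    fix f g assume "f \<in> fin_supp r natLeq" "g \<in> fin_supp r natLeq" "f \<noteq> g"
    then have "{f, g} \<noteq> {}" "{f, g} \<subseteq> fin_supp r natLeq" by auto
    from oexp_natLeq_least[OF r this]
    show "(f, g) \<in> ?p \<or> (g, f) \<in> ?p" by auto
  qed
  have lin: "Linear_order ?p"
    using refl antisym trans total by (auto simp: order_on_defs Field_def)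
  have "wf (?p - Id)"
  proof (rule wfI_min)
    fix f :: "nat \<Rightarrow> 'a" and S assume f: "f \<in> S"
    show "\<exists>g\<in>S. \<forall>h. (h, g) \<in> ?p - Id \<longrightarrow> h \<notin> S"
    proof (cases "S \<inter> fin_supp r natLeq = {}")
      case True
      then show ?thesis using f by (auto simp: mem_oexp_natLeq)
    next
      case False
      then obtain g where g: "g \<in> S \<inter> fin_supp r natLeq"
        and least: "\<forall>h \<in> S \<inter> fin_supp r natLeq. (g, h) \<in> ?p"
        using oexp_natLeq_least[OF r False] by blast
      have "h \<notin> S" if "(h, g) \<in> ?p - Id" for h
      proof
        assume "h \<in> S"
        then have "(g, h) \<in> ?p" using least that by (auto simp: mem_oexp_natLeq)
        then show False using that antisym by (auto simp: antisym_def)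
      qed
      then show ?thesis using g by blast
    qed
  qed
  then show ?thesis using lin by (simp add: well_order_on_def)
qed

section \<open>Traversals that follow a parent map\<close>

text \<open>A vertex is coded by the sequence of its iterated parents, with the
  vertex itself as the least significant entry.  At the largest difference of two codes the entries
  are siblings, so there the traversal agrees with \<open>lt\<close>.\<close>

lemma ordLeq_oexp_natLeq_if_parent_map:
  fixes par :: "'a \<Rightarrow> 'a" and \<alpha> :: "'b rel"
  assumes prec: "well_order_on V prec" and lt: "well_order_on V lt" and iso: "lt =o \<alpha>"
    and root: "v0 \<in> V" "\<And>v. v \<in> V \<Longrightarrow> (v0, v) \<in> lt" "par v0 = v0"
    and par_less: "\<And>v. v \<in> V \<Longrightarrow> v \<noteq> v0 \<Longrightarrow> (par v, v) \<in> prec - Id"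
    and par_mono: "\<And>v w. (v, w) \<in> prec \<Longrightarrow> (par v, par w) \<in> prec"
    and siblings: "\<And>v w. (v, w) \<in> prec \<Longrightarrow> par v = par w \<Longrightarrow> (v, w) \<in> lt"
  shows "prec \<le>o \<alpha> ^o natLeq"
proof -
  have F: "Field prec = V" "Field lt = V"
    using prec lt well_order_on_Field by blast+
  have wo: "Well_order prec" "Well_order lt" "Well_order \<alpha>"
    using prec lt iso F ordIso_Well_order_simp by metis+
  interpret A: wo_rel \<alpha> using wo(3) by (simp add: wo_rel_def)
  have par_V: "par v \<in> V" if "v \<in> V" for v
    using par_less[OF that] root F(1) that by (cases "v = v0") (auto simp: Field_def)
  then have iter_V: "(par ^^ i) v \<in> V" if "v \<in> V" for v i
    using that by (induction i) auto
  have root_iter: "(par ^^ i) v0 = v0" for i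
    using root(3) by (induction i) auto
  obtain g where g: "bij_betw g V (Field \<alpha>)"
    and g_iff: "\<And>x y. x \<in> V \<Longrightarrow> y \<in> V \<Longrightarrow> (x, y) \<in> lt \<longleftrightarrow> (g x, g y) \<in> \<alpha>"
  proof -
    from iso obtain g where "BNF_Wellorder_Embedding.iso lt \<alpha> g"
      unfolding ordIso_def by blast
    then have "bij_betw g V (Field \<alpha>)"
      "\<forall>x\<in>V. \<forall>y\<in>V. (x, y) \<in> lt \<longleftrightarrow> (g x, g y) \<in> \<alpha>"
      unfolding iso_iff2 F(2) by simp_all
    then show thesis
      using that[of g] by simp
  qed
  have g_root: "g v0 = A.zero"
  proof -
    have "Field \<alpha> \<noteq> {}" using g root(1) by (auto simp: bij_betw_def)
    then have "A.zero \<in> g ` V"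
      using A.zero_in_Field g by (simp add: bij_betw_def)
    then obtain u where u: "u \<in> V" "A.zero = g u" by blast
    then have "(g v0, A.zero) \<in> \<alpha>"
      using root(1,2) g_iff by simp
    then show ?thesis by (rule A.leq_zero_imp)
  qed
  \<comment> \<open>Finite support of the codes needs the default value \<open>g v0\<close> to be the zero of \<open>\<alpha>\<close>.\<close>
  define code where "code v = (\<lambda>i. g ((par ^^ i) v))" for v
  have ex_root: "\<exists>n. (par ^^ n) v = v0" if "v \<in> V" for v
  proof -
    have "wf (prec - Id)" using wo(1) by (simp add: well_order_on_def)
    then show ?thesis using that
    proof (induction v rule: wf_induct_rule)
      case (less v)
      show ?case
      proof (cases "v = v0")
        case True
        then show ?thesis by (metis funpow_0)
      next
        case False
        then obtain n where "(par ^^ n) (par v) = v0"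
          using less par_less par_V by blast
        then show ?thesis by (metis funpow_Suc_right o_apply)
      qed
    qed
  qed
  have supp: "finite {i. code v i \<noteq> A.zero}" if v: "v \<in> V" for v
  proof -
    obtain n where n: "(par ^^ n) v = v0" using ex_root[OF v] by blast
    have "i < n" if "code v i \<noteq> A.zero" for i
    proof (rule ccontr)
      assume "\<not> i < n"
      then have "(par ^^ i) v = (par ^^ (i - n)) ((par ^^ n) v)"
        by (metis add_diff_inverse_nat add.commute funpow_add o_apply)
      then show False using that n root_iter g_root by (simp add: code_def)
    qed
    then have "{i. code v i \<noteq> A.zero} \<subseteq> {..<n}" by auto
    then show ?thesis by (rule finite_subset) simp
  qed
  have code_in: "code v \<in> fin_supp \<alpha> natLeq" if "v \<in> V" for v
    using supp[OF that] iter_V[OF that] g by (auto simp: mem_fin_supp_natLeq code_def bij_betw_def)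
  show ?thesis
  proof (rule ordLeq_if_strict_mono[where f = code])
    show "Well_order prec" by (rule wo)
    show "Well_order (\<alpha> ^o natLeq)" using wo(3) by (rule Well_order_oexp_natLeq)
    show "code v \<in> Field (\<alpha> ^o natLeq)" if "v \<in> Field prec" for v
      using code_in that by (simp add: F(1) Field_oexp_natLeq)
    show "(code v, code w) \<in> \<alpha> ^o natLeq - Id" if vw: "(v, w) \<in> prec - Id" for v w
    proof -
      have V: "v \<in> V" "w \<in> V" using vw F(1) by (auto simp: Field_def)
      have inj: "g x = g y \<longleftrightarrow> x = y" if "x \<in> V" "y \<in> V" for x y
        using g that by (auto simp: bij_betw_def inj_on_def)
      have "code v 0 \<noteq> code w 0" using vw V inj by (auto simp: code_def)
      then obtain m where m: "code v m \<noteq> code w m" "\<And>i. m < i \<Longrightarrow> code v i = code w i"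
        using largest_difference[OF supp[OF V(1)] supp[OF V(2)]] by metis
      let ?x = "(par ^^ m) v" and ?y = "(par ^^ m) w"
      have "par ?x = par ?y"
        using m(2)[of "Suc m"] inj iter_V[of _ "Suc m"] V by (simp add: code_def)
      moreover have "(?x, ?y) \<in> prec"
        using vw par_mono by (induction m) auto
      ultimately have "(?x, ?y) \<in> lt" by (intro siblings)
      then have "(code v m, code w m) \<in> \<alpha> - Id"
        using m(1) g_iff iter_V V by (auto simp: code_def)
      then show ?thesis
        using m code_in V by (auto simp: mem_oexp_natLeq)
    qed
  qed
qed


section \<open>Unions of chains of end-extensions\<close>

text \<open>Wellfoundedness of the union is where end-extension, rather than mere inclusion, matters: a
  descending sequence stays inside the member of the chain that contains its first step.\<close>

lemma Well_order_Union_init_seg_chain: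
  assumes chain: "\<R> \<in> Chains init_seg_of" and wo: "\<And>r. r \<in> \<R> \<Longrightarrow> Well_order r"
  shows "Well_order (\<Union>\<R>)"
proof -
  have sub: "chain\<^sub>\<subseteq> \<R>"
    using chain by (auto simp: init_seg_of_def chain_subset_def Chains_def)
  have "Refl (\<Union>\<R>)"
  proof (rule refl_onI)
    fix x assume "x \<in> Field (\<Union>\<R>)"
    then obtain r where r: "r \<in> \<R>" "x \<in> Field r" by (auto simp: Field_def)
    then have "(x, x) \<in> r"
      using wo[OF r(1)] by (simp add: order_on_defs refl_on_def)
    then show "(x, x) \<in> \<Union>\<R>" using r(1) by blast
  qed
  moreover have "trans (\<Union>\<R>)"
    by (rule chain_subset_trans_Union[OF sub]) (use wo in \<open>auto simp: order_on_defs\<close>)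
  moreover have "antisym (\<Union>\<R>)"
    by (rule chain_subset_antisym_Union[OF sub]) (use wo in \<open>auto simp: order_on_defs\<close>)
  moreover have "Total (\<Union>\<R>)"
    by (rule chain_subset_Total_Union[OF sub]) (use wo in \<open>auto simp: order_on_defs\<close>)
  moreover have "wf (\<Union>\<R> - Id)"
  proof -
    have "\<Union>\<R> - Id = \<Union>{r - Id |r. r \<in> \<R>}" by blast
    moreover have "wf (\<Union>{r - Id |r. r \<in> \<R>})"
      by (rule wf_Union_wf_init_segs[OF Chains_inits_DiffI[OF chain]])
        (use wo in \<open>auto simp: order_on_defs\<close>)
    ultimately show ?thesis by simp
  qed
  ultimately show ?thesis
    by (auto simp: order_on_defs Field_def)
qed

lemma init_seg_of_Osum:
  assumes "Field r \<inter> Field s = {}"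
  shows "r initial_segment_of (r Osum s)"
  using assms by (auto simp: init_seg_of_def Osum_def Field_def)

section \<open>The stages of the search\<close>

locale bfs_search =
  fixes V :: "'a set" and E lt :: "'a rel"
  assumes graph: "wo_connected_graph V E lt" and nonempty: "V \<noteq> {}"
begin

abbreviation "R \<equiv> stage_ord V"
abbreviation "B \<equiv> bfs_B V E lt"
abbreviation "q \<equiv> bfs_q V E lt"
abbreviation "\<Gamma> \<equiv> bfs_closure V E lt"

definition Q :: "(nat + 'a) set \<Rightarrow> 'a rel" where
  "Q a = snd (bfs_stage V E lt a)"

definition v0 :: 'a where
  "v0 = wo_rel.minim lt V"

definition new :: "(nat + 'a) set \<Rightarrow> 'a set" where
  "new a = E `` {q a} - Field (Q a)"

definition active :: "(nat + 'a) set \<Rightarrow> bool" where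
  "active a \<longleftrightarrow> Field (Q a) - B a \<noteq> {}"

lemma Card_order_R: "Card_order R"
  unfolding stage_ord_def by (intro cardSuc_Card_order Card_order_csum)

lemma infinite_R: "infinite (Field R)"
proof -
  have "Cinfinite (natLeq +c |V| )" by (rule Cinfinite_csum1[OF natLeq_Cinfinite])
  from Cinfinite_cardSuc[OF this] show ?thesis
    by (simp add: stage_ord_def cinfinite_def)
qed

lemma card_V_less_R: "|V| <o R"
  unfolding stage_ord_def
  by (rule ordLeq_ordLess_trans[OF ordLeq_csum2[OF card_of_Card_order] cardSuc_greater])
    (rule Card_order_csum)

sublocale R: wo_rel R
  using Card_order_R by (simp add: wo_rel_def)

lemma Field_R_nonempty: "Field R \<noteq> {}"
  using infinite_R by auto

text \<open>An infinite cardinal has no largest element, so the successor equation of the recursion applies at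
  every stage.\<close>

lemma aboveS_R: "a \<in> Field R \<Longrightarrow> aboveS R a \<noteq> {}"
  using infinite_Card_order_limit[OF Card_order_R infinite_R] by (fastforce simp: aboveS_def)

lemma succ_R: "a \<in> Field R \<Longrightarrow> (a, R.succ a) \<in> R - Id" "a \<in> Field R \<Longrightarrow> R.succ a \<in> Field R"
  using R.succ_in[OF aboveS_R] R.succ_diff[OF aboveS_R] R.succ_in_Field[OF aboveS_R] by auto

lemma stage_induct [consumes 1, case_names zero succ lim]:
  assumes a: "a \<in> Field R"
    and zero: "P R.zero"
    and succ: "\<And>a. a \<in> Field R \<Longrightarrow> P a \<Longrightarrow> P (R.succ a)"
    and lim: "\<And>a. a \<in> Field R \<Longrightarrow> a \<noteq> R.zero \<Longrightarrow> R.isLim a \<Longrightarrow>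
      (\<And>b. b \<in> underS R a \<Longrightarrow> P b) \<Longrightarrow> P a"
  shows "P a"
proof -
  have "a \<in> Field R \<longrightarrow> P a"
  proof (induction a rule: R.well_order_inductZSL)
    case Zero
    then show ?case using zero by simp
  next
    case (Suc a)
    then have "a \<in> Field R" by (auto simp: aboveS_def Field_def)
    then show ?case using Suc succ by simp
  next
    case (Lim a)
    have "P b" if "b \<in> underS R a" for b
      using Lim(3)[OF that] that by (auto simp: underS_def Field_def)
    then show ?case using Lim lim by simp
  qed
  then show ?thesis using a by simp
qed

lemma adm_limit:
  "R.adm_woL (\<lambda>f a. (\<Union>b \<in> underS R a. fst (f b), \<Union>b \<in> underS R a. snd (f b)))"
  unfolding R.adm_woL_def by auto

lemma bfs_stage_zero: "bfs_stage V E lt R.zero = ({}, {(v0, v0)})"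
  unfolding bfs_stage_def R.worecZSL_zero[OF adm_limit] v0_def Let_def by (rule refl)

lemma bfs_stage_succ:
  "a \<in> Field R \<Longrightarrow> bfs_stage V E lt (R.succ a) = bfs_step E lt (bfs_stage V E lt a)"
  unfolding bfs_stage_def by (rule R.worecZSL_succ[OF adm_limit aboveS_R])

lemma bfs_stage_lim:
  "R.isLim a \<Longrightarrow> a \<noteq> R.zero \<Longrightarrow> bfs_stage V E lt a =
    (\<Union>b \<in> underS R a. fst (bfs_stage V E lt b), \<Union>b \<in> underS R a. snd (bfs_stage V E lt b))"
  unfolding bfs_stage_def by (rule R.worecZSL_isLim[OF adm_limit])

lemma bfs_stage_pair: "bfs_stage V E lt a = (B a, Q a)"
  by (simp add: bfs_B_def Q_def)

lemma B_zero: "B R.zero = {}" and Q_zero: "Q R.zero = {(v0, v0)}"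
  by (simp_all add: bfs_B_def Q_def bfs_stage_zero)

lemma q_eq: "q a = wo_rel.minim (Q a) (Field (Q a) - B a)"
  by (simp add: bfs_q_def queue_head_def bfs_stage_pair)

lemma B_succ: "a \<in> Field R \<Longrightarrow> B (R.succ a) = (if active a then insert (q a) (B a) else B a)"
  and Q_succ: "a \<in> Field R \<Longrightarrow>
    Q (R.succ a) = (if active a then Q a Osum Restr lt (new a) else Q a)"
  using bfs_stage_succ[of a]
  unfolding bfs_stage_pair bfs_step_def active_def new_def bfs_q_def
  by (auto simp: Let_def split: if_splits)

lemma B_lim: "R.isLim a \<Longrightarrow> a \<noteq> R.zero \<Longrightarrow> B a = (\<Union>b \<in> underS R a. B b)"
  and Q_lim: "R.isLim a \<Longrightarrow> a \<noteq> R.zero \<Longrightarrow> Q a = (\<Union>b \<in> underS R a. Q b)"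
  using bfs_stage_lim by (simp_all add: bfs_B_def Q_def)

lemma Field_Restr_new: "Field (Restr lt (new a)) \<inter> Field (Q a) = {}"
  by (auto simp: new_def Field_def)

text \<open>Later queues end-extend earlier ones: a step only appends vertices that are not yet queued.\<close>

lemma stage_mono:
  assumes "(b, a) \<in> R"
  shows "Q b initial_segment_of Q a \<and> B b \<subseteq> B a"
proof -
  have "a \<in> Field R" using assms by (auto simp: Field_def)
  then have "\<forall>b. (b, a) \<in> R \<longrightarrow> Q b initial_segment_of Q a \<and> B b \<subseteq> B a"
  proof (induction a rule: stage_induct)
    case zero
    then show ?case using R.leq_zero_imp by fastforce
  next
    case (succ a)
    have "Q a initial_segment_of Q (R.succ a)"
      using Q_succ[OF succ(1)] init_seg_of_Osum[of "Q a"] Field_Restr_new[of a]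
      by (auto simp: Int_commute)
    moreover have "B a \<subseteq> B (R.succ a)" using B_succ[OF succ(1)] by auto
    ultimately show ?case
      using succ.IH R.less_succ[OF aboveS_R[OF succ(1)]] trans_init_seg_of by fastforce
  next
    case (lim a)
    show ?case
    proof (intro allI impI)
      fix b assume "(b, a) \<in> R"
      then consider "b = a" | "b \<in> underS R a" by (auto simp: underS_def)
      then show "Q b initial_segment_of Q a \<and> B b \<subseteq> B a"
      proof cases
        case 2
        have "(x, y) \<in> Q b" if c: "c \<in> underS R a" "(x, y) \<in> Q c" and z: "(y, z) \<in> Q b" for x y z c
        proof -
          have "(b, c) \<in> R \<or> (c, b) \<in> R"
            using R.TOTALS 2 c(1) by (auto simp: underS_def Field_def)
          then show ?thesis
            using lim(4)[OF 2] lim(4)[OF c(1)] c(2) z unfolding init_seg_of_def by blast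
        qed
        then show ?thesis
          unfolding B_lim[OF lim(3,2)] Q_lim[OF lim(3,2)] using 2
          by (auto simp: init_seg_of_def)
      qed simp
    qed
  qed
  then show ?thesis using assms by blast
qed

lemma Q_mono: "(b, a) \<in> R \<Longrightarrow> Q b \<subseteq> Q a"
  and B_mono: "(b, a) \<in> R \<Longrightarrow> B b \<subseteq> B a"
  using stage_mono by (auto simp: init_seg_of_def)

lemma Field_Q_mono: "(b, a) \<in> R \<Longrightarrow> Field (Q b) \<subseteq> Field (Q a)"
  by (rule mono_Field[OF Q_mono])

lemma graph_facts: "E \<subseteq> V \<times> V" "u \<in> V \<Longrightarrow> v \<in> V \<Longrightarrow> (u, v) \<in> E\<^sup>*" "well_order_on V lt"
  using graph by (auto simp: wo_connected_graph_def)

lemma Field_lt: "Field lt = V"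
  using well_order_on_Field[OF graph_facts(3)] by simp

lemma Well_order_lt: "Well_order lt"
  using graph_facts(3) Field_lt by simp

lemma v0_in_V: "v0 \<in> V" and v0_least: "v \<in> V \<Longrightarrow> (v0, v) \<in> lt"
proof -
  interpret wo_rel lt using Well_order_lt by (simp add: wo_rel_def)
  show "v0 \<in> V" "v \<in> V \<Longrightarrow> (v0, v) \<in> lt"
    using nonempty unfolding v0_def by (auto simp: Field_lt intro: minim_in minim_least)
qed

lemma queue_invariant:
  assumes "a \<in> Field R"
  shows "Well_order (Q a) \<and> Field (Q a) \<subseteq> V"
  using assms
proof (induction a rule: stage_induct)
  case zero
  have "{(v0, v0)} - Id = {}" by auto
  then show ?case
    using v0_in_V by (auto simp: Q_zero order_on_defs Field_def refl_on_def trans_def antisym_def)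
next
  case (succ a)
  have "Well_order (Q a Osum Restr lt (new a))"
    using succ.IH Well_order_Restr[OF Well_order_lt] Field_Restr_new[of a]
    by (intro Osum_Well_order) auto
  moreover have "Field (Restr lt (new a)) \<subseteq> V"
    using Field_lt by (auto simp: Field_def)
  ultimately show ?case
    using succ.IH by (auto simp: Q_succ[OF succ(1)] Field_Osum)
next
  case (lim a)
  have "{Q b |b. b \<in> underS R a} \<in> Chains init_seg_of"
    using R.TOTALS stage_mono by (fastforce simp: Chains_def underS_def Field_def)
  then have "Well_order (\<Union>{Q b |b. b \<in> underS R a})"
    using lim.IH by (intro Well_order_Union_init_seg_chain) auto
  moreover have "\<Union>{Q b |b. b \<in> underS R a} = Q a"
    by (auto simp: Q_lim[OF lim(3,2)])
  moreover have "Field (Q a) \<subseteq> V"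
    using lim.IH unfolding Q_lim[OF lim(3,2)] by (fastforce simp: Field_def)
  ultimately show ?case by simp
qed

lemma Well_order_Q: "a \<in> Field R \<Longrightarrow> Well_order (Q a)"
  and Field_Q_subset: "a \<in> Field R \<Longrightarrow> Field (Q a) \<subseteq> V"
  using queue_invariant by auto

lemma Q_initial:
  assumes "(b, a) \<in> R" "(x, y) \<in> Q a" "y \<in> Field (Q b)"
  shows "(x, y) \<in> Q b"
proof -
  have "b \<in> Field R" using assms(1) by (auto simp: Field_def)
  then have "(y, y) \<in> Q b"
    using Well_order_Q[of b] assms(3) by (auto simp: order_on_defs refl_on_def)
  then show ?thesis
    using stage_mono[OF assms(1)] assms(2) unfolding init_seg_of_def by blast
qed

lemma antisym_Q: "a \<in> Field R \<Longrightarrow> (x, y) \<in> Q a \<Longrightarrow> (y, x) \<in> Q a \<Longrightarrow> x = y"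
  using Well_order_Q[of a] by (auto simp: order_on_defs antisym_def)

lemma total_Q:
  "a \<in> Field R \<Longrightarrow> x \<in> Field (Q a) \<Longrightarrow> y \<in> Field (Q a) \<Longrightarrow> (x, y) \<in> Q a \<or> (y, x) \<in> Q a"
  using Well_order_Q[of a] by (cases "x = y") (auto simp: order_on_defs total_on_def refl_on_def)

lemma v0_in_Q: "a \<in> Field R \<Longrightarrow> v0 \<in> Field (Q a)"
  using Field_Q_mono[OF R.zero_smallest] by (auto simp: Q_zero)

lemma q_in_Q: "a \<in> Field R \<Longrightarrow> active a \<Longrightarrow> q a \<in> Field (Q a) - B a"
  and q_least: "a \<in> Field R \<Longrightarrow> y \<in> Field (Q a) - B a \<Longrightarrow> (q a, y) \<in> Q a"
proof -
  assume a: "a \<in> Field R"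
  interpret wo_rel "Q a" using Well_order_Q[OF a] by (simp add: wo_rel_def)
  show "q a \<in> Field (Q a) - B a" if "active a"
    using that unfolding q_eq active_def by (intro minim_in) auto
  show "(q a, y) \<in> Q a" if "y \<in> Field (Q a) - B a"
    using that unfolding q_eq by (intro minim_least) auto
qed

text \<open>The head \<open>q a\<close> is the first queued vertex outside \<open>B a\<close>, so adding it keeps the searched vertices
  an initial segment of the queue.\<close>

lemma searched_initial:
  assumes "a \<in> Field R"
  shows "B a \<subseteq> Field (Q a) \<and> (\<forall>x y. (x, y) \<in> Q a \<longrightarrow> y \<in> B a \<longrightarrow> x \<in> B a)"
  using assms
proof (induction a rule: stage_induct)
  case zero
  then show ?case by (simp add: B_zero)
next
  case (succ a)
  show ?case
  proof (cases "active a")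
    case False
    then show ?thesis using succ by (simp add: B_succ Q_succ)
  next
    case True
    have q: "q a \<in> Field (Q a)" using q_in_Q[OF succ(1) True] by simp
    have "x \<in> insert (q a) (B a)"
      if xy: "(x, y) \<in> Q (R.succ a)" and y: "y \<in> insert (q a) (B a)" for x y
    proof -
      have "(x, y) \<in> Q a"
        using Q_initial[of a "R.succ a"] succ_R(1)[OF succ(1)] xy y q succ.IH by blast
      moreover from this have "x \<in> Field (Q a)" by (auto simp: Field_def)
      ultimately show ?thesis
        using y succ.IH q_least[OF succ(1), of x] antisym_Q[OF succ(1)] by blast
    qed
    then show ?thesis
      using True q succ by (auto simp: B_succ Q_succ Field_Osum)
  qed
next
  case (lim a)
  have "B b \<subseteq> Field (Q a)" if "b \<in> underS R a" for b
    using lim.IH[OF that] Field_Q_mono[of b a] that by (auto simp: underS_def)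
  moreover have "x \<in> B a" if "(x, y) \<in> Q a" "b \<in> underS R a" "y \<in> B b" for x y b
    using lim.IH[OF that(2)] Q_initial[of b a x y] B_mono[of b a] that
    by (auto simp: underS_def)
  moreover have "\<exists>b. b \<in> underS R a \<and> y \<in> B b" if "y \<in> B a" for y
    using that unfolding B_lim[OF lim(3,2)] by blast
  ultimately show ?case by blast
qed

lemma B_subset_Q: "a \<in> Field R \<Longrightarrow> B a \<subseteq> Field (Q a)"
  and B_initial: "a \<in> Field R \<Longrightarrow> (x, y) \<in> Q a \<Longrightarrow> y \<in> B a \<Longrightarrow> x \<in> B a"
  using searched_initial by blast+

lemma succ_leq: "(b, a) \<in> R - Id \<Longrightarrow> (R.succ b, a) \<in> R"
  using R.succ_smallest by auto

lemma less_leq_trans: "(a, b) \<in> R - Id \<Longrightarrow> (b, c) \<in> R \<Longrightarrow> (a, c) \<in> R - Id"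
  using R.TRANS R.ANTISYM by (auto dest: transD antisymD)

lemma Field_R: "(a, b) \<in> R \<Longrightarrow> a \<in> Field R" "(a, b) \<in> R \<Longrightarrow> b \<in> Field R"
  by (auto simp: Field_def)

text \<open>Limits add nothing new, so a vertex becomes searched at a successor stage, namely as the head of
  the queue; similarly for being queued, except that \<open>v0\<close> is queued from the beginning.\<close>

lemma searched_at_stage:
  assumes "a \<in> Field R" "u \<in> B a"
  shows "\<exists>c. (c, a) \<in> R - Id \<and> active c \<and> u = q c"
  using assms
proof (induction a rule: stage_induct)
  case zero
  then show ?case by (simp add: B_zero)
next
  case (succ a)
  then consider "u \<in> B a" | "active a" "u = q a"
    by (auto simp: B_succ split: if_splits)
  then show ?case
  proof cases
    case 1
    then show ?thesis
      using succ.IH less_leq_trans succ_R(1)[OF succ(1)] by blast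
  next
    case 2
    then show ?thesis using succ_R(1)[OF succ(1)] by blast
  qed
next
  case (lim a)
  then obtain b where b: "b \<in> underS R a" "u \<in> B b"
    using B_lim[OF lim(3,2)] by blast
  then have "(b, a) \<in> R" by (simp add: underS_def)
  then show ?case
    using lim(4)[OF b] less_leq_trans by blast
qed

lemma queued_at_stage:
  assumes "a \<in> Field R" "v \<in> Field (Q a)" "v \<noteq> v0"
  shows "\<exists>c. (c, a) \<in> R - Id \<and> active c \<and> v \<in> new c"
  using assms(1,2)
proof (induction a rule: stage_induct)
  case zero
  then show ?case using assms(3) by (simp add: Q_zero Field_def)
next
  case (succ a)
  then consider "v \<in> Field (Q a)" | "active a" "v \<in> Field (Restr lt (new a))"
    by (auto simp: Q_succ Field_Osum split: if_splits)
  then show ?case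
  proof cases
    case 1
    then show ?thesis
      using succ.IH less_leq_trans succ_R(1)[OF succ(1)] by blast
  next
    case 2
    then have "v \<in> new a" by (auto simp: Field_def)
    then show ?thesis using 2(1) succ_R(1)[OF succ(1)] by blast
  qed
next
  case (lim a)
  then obtain b where b: "b \<in> underS R a" "v \<in> Field (Q b)"
    unfolding Q_lim[OF lim(3,2)] by (auto simp: Field_def)
  then have "(b, a) \<in> R" by (simp add: underS_def)
  then show ?case
    using lim(4)[OF b] less_leq_trans by blast
qed

section \<open>The closure ordinal\<close>

lemma new_subset_V: "new a \<subseteq> V"
  using graph_facts(1) by (auto simp: new_def)

lemma new_queued:
  assumes "a \<in> Field R" "active a"
  shows "new a \<subseteq> Field (Q (R.succ a))"
proof
  fix v assume v: "v \<in> new a"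
  then have "(v, v) \<in> Restr lt (new a)"
    using new_subset_V Well_order_lt Field_lt by (auto simp: order_on_defs refl_on_def)
  then show "v \<in> Field (Q (R.succ a))"
    unfolding Q_succ[OF assms(1)] using assms(2) by (auto simp: Field_Osum intro: FieldI1)
qed

text \<open>When every queued vertex has been searched, the searched vertices contain \<open>v0\<close> and are closed under
  neighbors, since searching a vertex queues all its neighbors.  Connectedness then gives all of \<open>V\<close>.\<close>

lemma exhausted_queue_covers:
  assumes a: "a \<in> Field R" and "\<not> active a"
  shows "B a = V"
proof
  show "B a \<subseteq> V" using B_subset_Q Field_Q_subset a by blast
  have eq: "Field (Q a) \<subseteq> B a" using assms(2) by (simp add: active_def)
  have "v \<in> B a" if "(v0, v) \<in> E\<^sup>*" for v
    using that
  proof (induction rule: rtrancl_induct)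
    case base
    then show ?case using v0_in_Q[OF a] eq by auto
  next
    case (step u v)
    then obtain c where c: "(c, a) \<in> R - Id" "active c" "u = q c"
      using searched_at_stage[OF a] by blast
    then have "c \<in> Field R" using Field_R by blast
    then have "v \<in> Field (Q (R.succ c)) \<or> v \<in> Field (Q c)"
      using step(2) c new_queued by (auto simp: new_def)
    moreover have "(c, a) \<in> R" "(R.succ c, a) \<in> R"
      using c(1) succ_leq by auto
    ultimately show ?case
      using Field_Q_mono eq by blast
  qed
  then show "V \<subseteq> B a" using graph_facts(2)[OF v0_in_V] by blast
qed

text \<open>Two distinct unexhausted stages have distinct heads: the earlier head has been searched by the
  later stage, at which the later head has not.  As searched vertices come first in the queue, the
  order of searching agrees with the order of the queue.\<close>

lemma head_separates:
  assumes ab: "(a, b) \<in> R - Id" and act: "active a" "active b"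
  shows "q a \<in> B b" "q b \<notin> B b" "(q a, q b) \<in> Q b" "q a \<noteq> q b"
proof -
  have F: "a \<in> Field R" "b \<in> Field R" using ab Field_R by auto
  show qa: "q a \<in> B b"
    using B_succ[OF F(1)] act(1) B_mono[OF succ_leq[OF ab]] by auto
  show qb: "q b \<notin> B b" using q_in_Q[OF F(2) act(2)] by simp
  then show "q a \<noteq> q b" using qa by auto
  show "(q a, q b) \<in> Q b"
    using total_Q[OF F(2), of "q a" "q b"] q_in_Q[OF F(2) act(2)] B_subset_Q[OF F(2)] qa qb
      B_initial[OF F(2), of "q b" "q a"] by blast
qed

lemma q_inj:
  assumes "a \<in> Field R" "b \<in> Field R" "active a" "active b" "q a = q b"
  shows "a = b"
proof (rule ccontr)
  assume "a \<noteq> b"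
  then have "(a, b) \<in> R - Id \<or> (b, a) \<in> R - Id"
    using assms(1,2) R.TOTALS by blast
  then show False
    using assms head_separates(4) by metis
qed

lemma active_iff: "a \<in> Field R \<Longrightarrow> active a \<longleftrightarrow> B a \<noteq> B (R.succ a)"
  using B_succ[of a] q_in_Q[of a] by auto

text \<open>If no stage had an exhausted queue, the heads would inject the stages into \<open>V\<close>, contradicting
  \<open>card_V_less_R\<close>.\<close>

lemma closure_stage: "\<Gamma> \<in> Field R" "\<not> active \<Gamma>"
  and active_before_closure: "a \<in> underS R \<Gamma> \<Longrightarrow> active a"
proof -
  let ?S = "{a \<in> Field R. B a = B (R.succ a)}"
  have "?S \<noteq> {}"
  proof
    assume "?S = {}"
    then have act: "active a" if "a \<in> Field R" for a
      using active_iff that by auto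
    have "inj_on q (Field R)"
      using q_inj act by (auto intro!: inj_onI)
    moreover have "q ` Field R \<subseteq> V"
      using q_in_Q act Field_Q_subset by blast
    ultimately have "|Field R| \<le>o |V|"
      using card_of_ordLeq by blast
    then have "R \<le>o |V|"
      using card_of_Field_ordIso[OF Card_order_R] ordIso_ordLeq_trans ordIso_symmetric by blast
    then show False
      using card_V_less_R not_ordLess_ordLeq by blast
  qed
  moreover have "?S \<subseteq> Field R" by auto
  ultimately have "R.minim ?S \<in> ?S" "\<And>a. a \<in> ?S \<Longrightarrow> (R.minim ?S, a) \<in> R"
    using R.minim_in[of ?S] R.minim_least[of ?S] by blast+
  note \<Gamma> = this[folded bfs_closure_def]
  then show "\<Gamma> \<in> Field R" "\<not> active \<Gamma>"
    using active_iff by auto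
  show "active a" if "a \<in> underS R \<Gamma>"
  proof (rule ccontr)
    assume "\<not> active a"
    moreover have a: "a \<in> Field R" "(a, \<Gamma>) \<in> R" "a \<noteq> \<Gamma>"
      using that by (auto simp: underS_def Field_def)
    ultimately have "(\<Gamma>, a) \<in> R" using \<Gamma>(2)[of a] active_iff by auto
    then show False using a R.ANTISYM by (auto simp: antisym_def)
  qed
qed

text \<open>This replaces the closure ordinal by a property of single stages: once the queue is exhausted, all
  of \<open>V\<close> has been searched, so that no later stage can have an unsearched vertex in its queue.\<close>

lemma underS_closure: "underS R \<Gamma> = {a \<in> Field R. active a}"
proof safe
  fix a assume a: "a \<in> underS R \<Gamma>"
  then show "active a" by (rule active_before_closure)
  show "a \<in> Field R" using a by (auto simp: underS_def Field_def)
next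
  fix a assume a: "a \<in> Field R" "active a"
  have "(\<Gamma>, a) \<notin> R"
  proof
    assume "(\<Gamma>, a) \<in> R"
    then have "V \<subseteq> B a"
      using B_mono exhausted_queue_covers[OF closure_stage] by blast
    then show False
      using a Field_Q_subset by (auto simp: active_def)
  qed
  then show "a \<in> underS R \<Gamma>"
    using R.TOTALS a(1) closure_stage(1) by (auto simp: underS_def)
qed

section \<open>The traversal and the parent map\<close>

abbreviation "prec \<equiv> bfs_traversal V E lt"

lemma mem_traversal:
  "(v, w) \<in> prec \<longleftrightarrow> (\<exists>a b. v = q a \<and> w = q b \<and> (a, b) \<in> R \<and> active a \<and> active b)"
  unfolding bfs_traversal_def underS_closure by (auto simp: Field_def)

lemma vertex_is_head:
  assumes "v \<in> V"
  obtains a where "a \<in> Field R" "active a" "v = q a"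
proof -
  have "v \<in> B \<Gamma>" using assms exhausted_queue_covers[OF closure_stage] by simp
  then obtain a where "(a, \<Gamma>) \<in> R - Id" "active a" "v = q a"
    using searched_at_stage[OF closure_stage(1)] by blast
  then show thesis using that[of a] Field_R(1) by blast
qed

lemma head_in_V: "a \<in> Field R \<Longrightarrow> active a \<Longrightarrow> q a \<in> V"
  using q_in_Q Field_Q_subset by blast

lemma well_order_on_traversal: "well_order_on V prec"
proof -
  let ?r = "Restr R (underS R \<Gamma>)"
  have Field_r: "Field ?r = underS R \<Gamma>"
    using R.REFL unfolding underS_closure by (auto simp: Field_def refl_on_def)
  have "inj_on q (underS R \<Gamma>)"
    unfolding underS_closure by (rule inj_onI) (use q_inj in blast)
  then have "inj_on q (Field ?r)" by (simp only: Field_r)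
  moreover have "prec = dir_image ?r q"
    by (auto simp: bfs_traversal_def dir_image_def)
  moreover have "Well_order ?r"
    using Well_order_Restr R.WELL by blast
  ultimately have "Well_order prec"
    using Well_order_dir_image by metis
  moreover have "Field prec = q ` underS R \<Gamma>"
    by (simp only: \<open>prec = _\<close> dir_image_Field Field_r)
  then have "Field prec = V"
    unfolding underS_closure using head_in_V by (auto elim: vertex_is_head)
  ultimately show ?thesis by simp
qed

lemma queued_before_searched:
  assumes "a \<in> Field R" "active a" "c \<in> Field R" "q a \<in> new c"
  shows "(c, a) \<in> R - Id"
proof -
  have "(a, c) \<notin> R"
    using assms q_in_Q[of a] Field_Q_mono[of a c] by (auto simp: new_def)
  then show ?thesis
    using assms R.TOTALS by auto
qed

text \<open>First in, first out.  If \<open>q b\<close> had been queued by an earlier stage than \<open>q a\<close>, it would precede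
  \<open>q a\<close> in every queue that contains both, as queues grow at the end; but it is searched later.\<close>

lemma queue_order_follows_search_order:
  assumes ab: "(a, b) \<in> R" "active a" "active b"
    and c: "c \<in> Field R" "active c" "q a \<in> new c"
    and d: "d \<in> Field R" "active d" "q b \<in> new d"
  shows "(c, d) \<in> R"
proof (rule ccontr)
  assume "(c, d) \<notin> R"
  then have dc: "(d, c) \<in> R - Id" using R.TOTALS c(1) d(1) by auto
  have ca: "(c, a) \<in> R - Id"
    using queued_before_searched ab c Field_R(1) by blast
  have qb: "q b \<in> Field (Q c)"
    using new_queued[OF d(1,2)] d(3) Field_Q_mono[OF succ_leq[OF dc]] by blast
  have "a \<noteq> b" using c(3) qb by (auto simp: new_def)
  then have "(q a, q b) \<in> Q b" using head_separates(3) ab by blast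
  moreover have "(c, b) \<in> R" using less_leq_trans[OF ca ab(1)] by simp
  ultimately have "(q a, q b) \<in> Q c" using Q_initial qb by blast
  then show False using c(3) by (auto simp: new_def Field_def)
qed

text \<open>Vertices queued by the same stage occur in the queue in \<open>lt\<close>-order, and the queue is searched in
  its own order.\<close>

lemma siblings_searched_in_order:
  assumes ab: "(a, b) \<in> R" "active a" "active b"
    and c: "c \<in> Field R" "active c" "q a \<in> new c" "q b \<in> new c"
  shows "(q a, q b) \<in> lt"
proof (cases "a = b")
  case True
  then show ?thesis
    using c(3) new_subset_V Well_order_lt Field_lt by (auto simp: order_on_defs refl_on_def)
next
  case False
  then have "(q a, q b) \<in> Q b" using head_separates(3) ab by blast
  moreover have "(R.succ c, b) \<in> R"
    using queued_before_searched ab c Field_R(2) by (blast intro: succ_leq)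
  moreover have "q b \<in> Field (Q (R.succ c))" using new_queued[OF c(1,2)] c(4) by blast
  ultimately have "(q a, q b) \<in> Q (R.succ c)" using Q_initial by blast
  moreover have "q a \<notin> Field (Q c)" "q b \<notin> Field (Q c)" using c by (auto simp: new_def)
  ultimately show ?thesis
    using c(2) by (auto simp: Q_succ[OF c(1)] Osum_def Field_def)
qed

text \<open>By \<open>queue_order_follows_search_order\<close> only one stage queues a given vertex, so the choice is
  unique.  Making \<open>v0\<close> its own parent lets every iterated-parent sequence end in the constant \<open>v0\<close>.\<close>

definition parent :: "'a \<Rightarrow> 'a" where
  "parent v = (if v = v0 then v0 else q (SOME c. c \<in> Field R \<and> active c \<and> v \<in> new c))"

lemma parent_root: "parent v0 = v0"
  by (simp add: parent_def)

lemma parent_stage: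
  assumes "v \<in> V" "v \<noteq> v0"
  obtains c where "c \<in> Field R" "active c" "v \<in> new c" "parent v = q c"
proof -
  obtain a where "a \<in> Field R" "active a" "v = q a"
    using vertex_is_head[OF assms(1)] .
  then have "\<exists>c. (c, a) \<in> R - Id \<and> active c \<and> v \<in> new c"
    using queued_at_stage assms(2) q_in_Q by blast
  then have "\<exists>c. c \<in> Field R \<and> active c \<and> v \<in> new c"
    using Field_R(1) by blast
  note c = someI_ex[OF this]
  show thesis
    by (rule that[of "SOME c. c \<in> Field R \<and> active c \<and> v \<in> new c"])
      (use c assms(2) in \<open>simp_all add: parent_def\<close>)
qed

lemma root_searched_first: "active R.zero" "q R.zero = v0"
proof -
  show act: "active R.zero" by (simp add: active_def Q_zero B_zero Field_def)
  show "q R.zero = v0"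
    using q_in_Q[OF R.zero_in_Field[OF Field_R_nonempty] act] by (simp add: Q_zero Field_def)
qed

lemma root_first:
  assumes "v \<in> V"
  shows "(v0, v) \<in> prec"
proof -
  obtain a where "a \<in> Field R" "active a" "v = q a"
    using vertex_is_head[OF assms] .
  then show ?thesis
    using root_searched_first R.zero_smallest unfolding mem_traversal by metis
qed

lemma parent_less:
  assumes v: "v \<in> V" "v \<noteq> v0"
  shows "(parent v, v) \<in> prec - Id"
proof -
  obtain a where a: "a \<in> Field R" "active a" "v = q a"
    using vertex_is_head[OF v(1)] .
  obtain c where c: "c \<in> Field R" "active c" "v \<in> new c" "parent v = q c"
    using parent_stage[OF v] .
  have ca: "(c, a) \<in> R - Id"
    using queued_before_searched a c by blast
  then have "parent v \<noteq> v" using head_separates(4) a c by metis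
  moreover have "(parent v, v) \<in> prec"
    using ca a c unfolding mem_traversal by blast
  ultimately show ?thesis by simp
qed

lemma prec_Field: "(v, w) \<in> prec \<Longrightarrow> v \<in> V \<and> w \<in> V"
  using well_order_on_Field[OF well_order_on_traversal] by (auto simp: Field_def)

lemma prec_antisym: "(v, w) \<in> prec \<Longrightarrow> (w, v) \<in> prec \<Longrightarrow> v = w"
  using well_order_on_traversal by (auto simp: order_on_defs antisym_def)

lemma parent_in_V: "v \<in> V \<Longrightarrow> parent v \<in> V"
  using parent_less prec_Field parent_root v0_in_V by (cases "v = v0") auto

lemma parent_mono:
  assumes vw: "(v, w) \<in> prec"
  shows "(parent v, parent w) \<in> prec"
proof (cases "v = v0")
  case True
  then show ?thesis
    using root_first parent_in_V prec_Field[OF vw] parent_root by simp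
next
  case False
  have V: "v \<in> V" "w \<in> V" using prec_Field[OF vw] by auto
  have "w \<noteq> v0" using False vw root_first[OF V(1)] prec_antisym by blast
  with False V obtain c d where
    c: "c \<in> Field R" "active c" "v \<in> new c" "parent v = q c" and
    d: "d \<in> Field R" "active d" "w \<in> new d" "parent w = q d"
    using parent_stage by metis
  obtain a b where "v = q a" "w = q b" "(a, b) \<in> R" "active a" "active b"
    using vw unfolding mem_traversal by blast
  then have "(c, d) \<in> R"
    using queue_order_follows_search_order c d by blast
  then show ?thesis
    using c d unfolding mem_traversal by blast
qed

lemma siblings_in_order:
  assumes vw: "(v, w) \<in> prec" and eq: "parent v = parent w"
  shows "(v, w) \<in> lt"
proof (cases "v = v0")
  case True
  then show ?thesis using v0_least prec_Field[OF vw] by simp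
next
  case False
  have V: "v \<in> V" "w \<in> V" using prec_Field[OF vw] by auto
  have "w \<noteq> v0" using False vw root_first[OF V(1)] prec_antisym by blast
  with False V obtain c d where
    c: "c \<in> Field R" "active c" "v \<in> new c" "parent v = q c" and
    d: "d \<in> Field R" "active d" "w \<in> new d" "parent w = q d"
    using parent_stage by metis
  then have "c = d" using q_inj eq by metis
  moreover obtain a b where "v = q a" "w = q b" "(a, b) \<in> R" "active a" "active b"
    using vw unfolding mem_traversal by blast
  ultimately show ?thesis
    using siblings_searched_in_order c d by blast
qed

end

theorem corollary5p8:
  fixes V :: "'a set" and E lt prec :: "'a rel" and \<alpha> :: "'b rel"
  assumes "wo_connected_graph V E lt"
    and "V \<noteq> {}"
    and "prec = bfs_traversal V E lt"
    and "lt =o \<alpha>"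
  shows "well_order_on V prec \<and> prec \<le>o \<alpha> ^o natLeq"
proof -
  interpret bfs_search V E lt
    using assms(1,2) by unfold_locales
  have "bfs_traversal V E lt \<le>o \<alpha> ^o natLeq"
    using well_order_on_traversal graph_facts(3) assms(4) v0_in_V v0_least parent_root
      parent_less parent_mono siblings_in_order
    by (rule ordLeq_oexp_natLeq_if_parent_map)
  then show ?thesis
    using well_order_on_traversal assms(3) by simp
qed

end
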